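(* Let $m,n\ge2$ be two integers and $d=\gcd(m,n)$. Then $$[\mathbb{D}_{2n}^d]\circledcirc[\mathbb{Z}_m\oplus\mathbb{Z}_2^c]=\begin{cases}\{[\mathbb{1}],[\mathbb{Z}_2],[\mathbb{Z}_2^-],[\mathbb{Z}_{2d}^-]\}&\text{if } m/d\text{ is even},\\ \{[\mathbb{1}],[\mathbb{Z}_2],[\mathbb{Z}_2^-],[\mathbb{Z}_d]\}&\text{if } m\text{ is even and } m/d\text{ is odd},\\ \{[\mathbb{1}],[\mathbb{Z}_d]\}&\text{otherwise}.\end{cases}$$ (The superscript $d$ in $\mathbb{D}_{2n}^d$ is part of the name of the group and is unrelated to the integer $d$.)
   Context: $[K]$ is the conjugacy class of a subgroup $K$ in $\mathrm{O}(3)$, and the clips operation is $[H_1]\circledcirc[H_2]=\{[H_1\cap gH_2g^{-1}]:g\in\mathrm{O}(3)\}$. $(e_1,e_2,e_3)$ is the canonical basis of $\mathbb{R}^3$, $\mathbf{r}(n,\theta)$ is the rotation by angle $\theta$ about the axis directed by $n\neq0$. $\mathbb{1}=\{\mathrm{Id}\}$; $\mathbb{Z}_2^c=\{\pm\mathrm{Id}\}$; $H\oplus\mathbb{Z}_2^c=H\cup(-H)$ for $H\subset\mathrm{SO}(3)$; $\mathbb{Z}_k=\{\mathbf{r}(e_3,2j\pi/k):0\le j\le k-1\}$, with $\mathbb{Z}_1=\mathbb{1}$; $\mathbb{D}_k=\langle\mathbf{r}(e_3,2\pi/k),\mathbf{r}(e_1,\pi)\rangle$ for $k\ge2$; $\mathbb{Z}_{2k}^-=\mathbb{Z}_k\cup(-\mathbf{r}(e_3,\pi/k))\mathbb{Z}_k$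 for $k\ge1$; $\mathbb{D}_{2k}^d=\mathbb{D}_k\cup(-\mathbf{r}(e_3,\pi/k))\mathbb{D}_k$. *)

theory Defs
  imports "HOL-Analysis.Analysis" "HOL-Analysis.Cross3" "HOL-Algebra.Generated_Groups"
begin

definition O3 :: "(real^3^3) monoid" where
  "O3 = \<lparr>carrier = {A. orthogonal_matrix A}, mult = (**), one = mat 1\<rparr>"

lemma O3_simps [simp]:
  "carrier O3 = {A. orthogonal_matrix A}"
  "x \<otimes>\<^bsub>O3\<^esub> y = x ** y"
  "\<one>\<^bsub>O3\<^esub> = mat 1"
  by (simp_all add: O3_def)

lemma group_O3: "group O3"
proof (rule groupI)
  fix x assume "x \<in> carrier O3"
  then show "\<exists>y\<in>carrier O3. y \<otimes>\<^bsub>O3\<^esub> x = \<one>\<^bsub>O3\<^esub>"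
    by (intro bexI[of _ "transpose x"]) (auto simp: orthogonal_matrix_def)
qed (auto simp: orthogonal_matrix_mul orthogonal_matrix_id matrix_mul_assoc)

lemma inv_O3: "orthogonal_matrix g \<Longrightarrow> inv\<^bsub>O3\<^esub> g = transpose g"
  by (rule group.inv_equality[OF group_O3]) (auto simp: orthogonal_matrix_def)

definition conjugate :: "real^3^3 \<Rightarrow> (real^3^3) set \<Rightarrow> (real^3^3) set" where
  "conjugate g K = (\<lambda>h. g \<otimes>\<^bsub>O3\<^esub> h \<otimes>\<^bsub>O3\<^esub> inv\<^bsub>O3\<^esub> g) ` K"

definition conj_class :: "(real^3^3) set \<Rightarrow> (real^3^3) set set" where
  "conj_class K = {conjugate g K | g. g \<in> carrier O3}"

text \<open>The clips operation acts on conjugacy classes; all representatives are used, so that no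
  choice is involved. Lemma \<open>clips_conj_class\<close> recovers the formula for fixed representatives.\<close>

definition clips :: "(real^3^3) set set \<Rightarrow> (real^3^3) set set \<Rightarrow> (real^3^3) set set set"
    (infixl "\<circledcirc>" 70) where
  "C1 \<circledcirc> C2 = {conj_class (H1 \<inter> conjugate g H2) | H1 H2 g.
     H1 \<in> C1 \<and> H2 \<in> C2 \<and> g \<in> carrier O3}"

lemma conjugate_conjugate:
  assumes "orthogonal_matrix a" "orthogonal_matrix b"
  shows "conjugate a (conjugate b K) = conjugate (a ** b) K"
  using assms
  by (simp add: conjugate_def image_image inv_O3 orthogonal_matrix_mul matrix_transpose_mul
      matrix_mul_assoc)

lemma conjugate_one: "conjugate (mat 1) K = K"
  by (simp add: conjugate_def inv_O3 orthogonal_matrix_id transpose_mat)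

lemma conjugate_Int:
  assumes "orthogonal_matrix a"
  shows "conjugate a (H \<inter> K) = conjugate a H \<inter> conjugate a K"
proof -
  have "inj (\<lambda>h. a ** h ** transpose a)"
  proof (rule inj_on_inverseI)
    fix h
    have "transpose a ** (a ** h ** transpose a) ** a
        = (transpose a ** a) ** h ** (transpose a ** a)"
      by (simp only: matrix_mul_assoc)
    then show "transpose a ** (a ** h ** transpose a) ** a = h"
      using assms by (simp add: orthogonal_matrix_def)
  qed
  then show ?thesis
    using assms by (simp add: conjugate_def inv_O3 image_Int)
qed

lemma conj_class_conjugate:
  assumes a: "orthogonal_matrix a"
  shows "conj_class (conjugate a K) = conj_class K"
proof (intro Set.set_eqI iffI)
  fix X assume "X \<in> conj_class (conjugate a K)"
  then obtain g where "orthogonal_matrix g" "X = conjugate g (conjugate a K)"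
    by (auto simp: conj_class_def)
  then have "orthogonal_matrix (g ** a)" "X = conjugate (g ** a) K"
    using a by (simp_all add: conjugate_conjugate orthogonal_matrix_mul)
  then show "X \<in> conj_class K" by (auto simp: conj_class_def)
next
  fix X assume "X \<in> conj_class K"
  then obtain g where g: "orthogonal_matrix g" "X = conjugate g K"
    by (auto simp: conj_class_def)
  have ta: "orthogonal_matrix (transpose a)" "transpose a ** a = mat 1"
    using a by (simp_all add: orthogonal_matrix_def)
  then have o: "orthogonal_matrix (g ** transpose a)"
    using g by (simp add: orthogonal_matrix_mul)
  have "(g ** transpose a) ** a = g"
    using ta by (simp add: matrix_mul_assoc[symmetric])
  then have "X = conjugate (g ** transpose a) (conjugate a K)"
    using g o a by (simp add: conjugate_conjugate)
  then show "X \<in> conj_class (conjugate a K)" using o by (auto simp: conj_class_def)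
qed

lemma clips_conj_class:
  "conj_class H1 \<circledcirc> conj_class H2 = {conj_class (H1 \<inter> conjugate g H2) | g. g \<in> carrier O3}"
proof (intro Set.set_eqI iffI)
  fix X assume "X \<in> conj_class H1 \<circledcirc> conj_class H2"
  then obtain a b g where o: "orthogonal_matrix a" "orthogonal_matrix b" "orthogonal_matrix g"
    and X: "X = conj_class (conjugate a H1 \<inter> conjugate g (conjugate b H2))"
    by (auto simp: clips_def conj_class_def)
  let ?c = "transpose a ** (g ** b)"
  have c: "orthogonal_matrix ?c"
    using o by (simp add: orthogonal_matrix_mul)
  have "a ** ?c = g ** b"
    using o by (simp add: matrix_mul_assoc orthogonal_matrix_def)
  then have "conjugate g (conjugate b H2) = conjugate a (conjugate ?c H2)"
    using o c by (simp add: conjugate_conjugate)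
  then have "X = conj_class (H1 \<inter> conjugate ?c H2)"
    using X o by (simp add: conjugate_Int[symmetric] conj_class_conjugate)
  then show "X \<in> {conj_class (H1 \<inter> conjugate g H2) | g. g \<in> carrier O3}"
    using c by auto
next
  fix X assume "X \<in> {conj_class (H1 \<inter> conjugate g H2) | g. g \<in> carrier O3}"
  moreover have "K \<in> conj_class K" for K
    using conjugate_one[of K] orthogonal_matrix_id by (force simp: conj_class_def)
  ultimately show "X \<in> conj_class H1 \<circledcirc> conj_class H2"
    by (auto simp: clips_def)
qed

text \<open>Rodrigues' formula, with the axis normalised: the rotation by the angle \<open>\<theta>\<close> about the
  oriented axis directed by \<open>n\<close>, for \<open>n \<noteq> 0\<close>.\<close>

definition rot :: "real^3 \<Rightarrow> real \<Rightarrow> real^3^3" where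
  "rot n \<theta> = matrix (\<lambda>v. cos \<theta> *\<^sub>R v + sin \<theta> *\<^sub>R cross3 (sgn n) v
     + ((1 - cos \<theta>) * (sgn n \<bullet> v)) *\<^sub>R sgn n)"

abbreviation e1 :: "real^3" where "e1 \<equiv> axis 1 1"
abbreviation e3 :: "real^3" where "e3 \<equiv> axis 3 1"

lemma sgn_axis: "sgn (axis k 1 :: real^3) = axis k 1"
  by (simp add: sgn_div_norm norm_eq_1 inner_axis_axis)

lemma rot_e3:
  "rot e3 \<theta> = vector [vector [cos \<theta>, - sin \<theta>, 0], vector [sin \<theta>, cos \<theta>, 0], vector [0, 0, 1]]"
  unfolding rot_def sgn_axis
  by (auto simp: vec_eq_iff forall_3 matrix_def cross3_def inner_vec_def sum_3 axis_def)

lemma rot_e1_pi: "rot e1 pi = vector [vector [1, 0, 0], vector [0, -1, 0], vector [0, 0, -1]]"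
  unfolding rot_def sgn_axis
  by (auto simp: vec_eq_iff forall_3 matrix_def cross3_def inner_vec_def sum_3 axis_def)

definition trivial_grp :: "(real^3^3) set" where
  "trivial_grp = {mat 1}"

definition plus_Z2c :: "(real^3^3) set \<Rightarrow> (real^3^3) set" where
  "plus_Z2c H = H \<union> uminus ` H"

definition Zgrp :: "nat \<Rightarrow> (real^3^3) set" where
  "Zgrp k = {rot e3 (2 * real j * pi / real k) | j. j < k}"

definition Dgrp :: "nat \<Rightarrow> (real^3^3) set" where
  "Dgrp k = generate O3 {rot e3 (2 * pi / real k), rot e1 pi}"

text \<open>In the next two definitions the argument is half of the index in the usual notation:
  \<open>Z2k_minus k\<close> is $\mathbb{Z}_{2k}^-$ and \<open>D2k_d k\<close> is $\mathbb{D}_{2k}^d$.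
  In particular $\mathbb{Z}_2^-$ is \<open>Z2k_minus 1\<close>.\<close>

definition Z2k_minus :: "nat \<Rightarrow> (real^3^3) set" where
  "Z2k_minus k = Zgrp k \<union> ((- rot e3 (pi / real k)) <#\<^bsub>O3\<^esub> Zgrp k)"

definition D2k_d :: "nat \<Rightarrow> (real^3^3) set" where
  "D2k_d k = Dgrp k \<union> ((- rot e3 (pi / real k)) <#\<^bsub>O3\<^esub> Dgrp k)"

end

theory Submission
  imports Defs
begin

text \<open>
  Conjugating \<open>Zgrp m\<close> and its negatives by \<open>g\<close> turns the rotation axis \<open>e3\<close> into \<open>g e3\<close>, the third
  column of \<open>g\<close>, and the intersection with \<open>D2k_d n\<close> is governed by the position of that axis. The
  elements of \<open>D2k_d n\<close> are, in terms of the angle \<open>x\<close>, the rotations by \<open>x\<close> about \<open>e3\<close> and the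
  half-turns about the horizontal axis at angle \<open>x / 2\<close>, taken with sign \<open>+\<close> when \<open>n x\<close> is an even
  multiple of \<open>\<pi>\<close> and with sign \<open>-\<close> when it is an odd one.

  If \<open>g e3 = \<plusminus> e3\<close>, then conjugation by \<open>g\<close> preserves every rotation about \<open>e3\<close> up to the sense of
  rotation, hence preserves the cyclic group, and the intersection consists of the \<open>\<plusminus>\<close> rotations by
  the common angles. By Bezout's identity the angles with sign \<open>+\<close> are those of \<open>Zgrp d\<close>; an angle
  with sign \<open>-\<close> satisfies \<open>d x = t \<pi>\<close> with \<open>t\<close> odd and \<open>(m / d) t\<close> even, which is possible exactly
  when \<open>m / d\<close> is even (\<open>D2k_d_Int_on_axis\<close>).

  If \<open>g e3\<close> is not \<open>\<plusminus> e3\<close>, a rotation about \<open>g e3\<close> other than the identity can agree with an element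
  of \<open>D2k_d n\<close> up to sign only when it is a half-turn about a horizontal axis, since any rotation
  about \<open>e3\<close> that fixes \<open>g e3\<close> is trivial. The determinant decides which sign is involved, and
  \<open>D2k_d n\<close> never contains both an element and its negative. So the intersection is the identity
  alone or has one further element, which is a half-turn or the negative of one
  (\<open>Int_conjugate_off_axis\<close>). The last two possibilities need the half-turn to lie in the cyclic
  group, that is \<open>m\<close> even, and then both occur, for \<open>g e3\<close> on a suitable horizontal axis; an axis
  that is neither horizontal nor vertical gives the trivial group.
\<close>

section \<open>Rotations and half-turns\<close>

text \<open>The angles \<open>x\<close> for which \<open>exp (\<i> x)\<close> is a \<open>k\<close>-th root of \<open>1\<close>, respectively of \<open>-1\<close>. Sets of
  angles closed under the period avoid choosing representatives \<open>0 \<le> j < k\<close>, so that divisibility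
  arguments take place over the integers.\<close>

definition root_angles :: "nat \<Rightarrow> real set" where
  "root_angles k = {x. \<exists>i::int. real k * x = 2 * of_int i * pi}"

definition antiroot_angles :: "nat \<Rightarrow> real set" where
  "antiroot_angles k = {x. \<exists>i::int. real k * x = (2 * of_int i + 1) * pi}"

text \<open>This is the half-turn about the horizontal axis directed by \<open>(cos (x/2), sin (x/2), 0)\<close>. The
  doubled angle makes the multiplication rules with rotations free of fractions.\<close>

definition half_turn :: "real \<Rightarrow> real^3^3" where
  "half_turn x = rot e3 x ** rot e1 pi"

lemmas matrix3_simps = vec_eq_iff forall_3 matrix_matrix_mult_def sum_3 transpose_def mat_def

lemma half_turn_matrix:
  "half_turn x = vector [vector [cos x, sin x, 0], vector [sin x, - cos x, 0], vector [0, 0, -1]]"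
  unfolding half_turn_def rot_e3 rot_e1_pi by (simp add: matrix3_simps)

lemma rot_e3_zero: "rot e3 0 = mat 1"
  unfolding rot_e3 by (simp add: matrix3_simps)

lemma rot_e3_mult: "rot e3 x ** rot e3 y = rot e3 (x + y)"
  unfolding rot_e3 by (simp add: matrix3_simps cos_add sin_add)

lemma rot_e3_half_turn: "rot e3 x ** half_turn y = half_turn (x + y)"
  by (simp add: half_turn_def matrix_mul_assoc rot_e3_mult)

lemma half_turn_rot_e3: "half_turn x ** rot e3 y = half_turn (x - y)"
  unfolding half_turn_matrix rot_e3 by (simp add: matrix3_simps cos_diff sin_diff)

lemma half_turn_mult: "half_turn x ** half_turn y = rot e3 (x - y)"
  unfolding half_turn_matrix rot_e3 by (simp add: matrix3_simps cos_diff sin_diff)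

lemma transpose_rot_e3: "transpose (rot e3 x) = rot e3 (- x)"
  unfolding rot_e3 by (simp add: matrix3_simps)

lemma transpose_half_turn: "transpose (half_turn x) = half_turn x"
  unfolding half_turn_matrix by (simp add: matrix3_simps)

lemma orthogonal_rot_e3: "orthogonal_matrix (rot e3 x)"
  by (simp add: orthogonal_matrix_def transpose_rot_e3 rot_e3_mult rot_e3_zero)

lemma orthogonal_half_turn: "orthogonal_matrix (half_turn x)"
  by (simp add: orthogonal_matrix_def transpose_half_turn half_turn_mult rot_e3_zero)

lemma matrix_mul_uminus_left: "(- A) ** B = - (A ** B)" for A B :: "real^3^3"
  by (simp add: matrix3_simps)

lemma matrix_mul_uminus_right: "A ** (- B) = - (A ** B)" for A B :: "real^3^3"
  by (simp add: matrix3_simps)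

lemma det_rot_e3: "det (rot e3 x) = 1"
  unfolding rot_e3 by (simp add: det_3 flip: power2_eq_square)

lemma det_half_turn: "det (half_turn x) = 1"
  unfolding half_turn_matrix by (simp add: det_3 flip: power2_eq_square)

lemma det_uminus3: "det (- A) = - det A" for A :: "real^3^3"
  by (simp add: det_3)

lemma rot_e3_neq_half_turn: "rot e3 x \<noteq> half_turn y"
  unfolding half_turn_matrix rot_e3 by (simp add: matrix3_simps)

lemma rot_e3_eq_iff: "rot e3 x = rot e3 y \<longleftrightarrow> (\<exists>i::int. x = y + 2 * pi * of_int i)"
  unfolding rot_e3 by (auto simp: matrix3_simps sin_cos_eq_iff[symmetric])

lemma half_turn_eq_iff: "half_turn x = half_turn y \<longleftrightarrow> rot e3 x = rot e3 y"
  unfolding rot_e3 half_turn_matrix by (auto simp: matrix3_simps)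

section \<open>Angles of roots of unity\<close>

lemma root_angles_cong:
  assumes "rot e3 x = rot e3 y"
  shows "x \<in> root_angles k \<longleftrightarrow> y \<in> root_angles k"
proof -
  have *: "b \<in> root_angles k" if "a = b + 2 * pi * of_int i" "a \<in> root_angles k" for a b and i :: int
  proof -
    from that obtain j :: int where "real k * a = 2 * of_int j * pi"
      by (auto simp: root_angles_def)
    then have "real k * b = 2 * of_int (j - int k * i) * pi"
      using that(1) by (simp add: algebra_simps)
    then show ?thesis unfolding root_angles_def by blast
  qed
  show ?thesis
    using * assms assms[symmetric] unfolding rot_e3_eq_iff by blast
qed

lemma antiroot_angles_cong:
  assumes "rot e3 x = rot e3 y"
  shows "x \<in> antiroot_angles k \<longleftrightarrow> y \<in> antiroot_angles k"
proof -
  have *: "b \<in> antiroot_angles k"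
    if "a = b + 2 * pi * of_int i" "a \<in> antiroot_angles k" for a b and i :: int
  proof -
    from that obtain j :: int where "real k * a = (2 * of_int j + 1) * pi"
      by (auto simp: antiroot_angles_def)
    then have "real k * b = (2 * of_int (j - int k * i) + 1) * pi"
      using that(1) by (simp add: algebra_simps)
    then show ?thesis unfolding antiroot_angles_def by blast
  qed
  show ?thesis
    using * assms assms[symmetric] unfolding rot_e3_eq_iff by blast
qed

lemma root_angles_disjoint: "x \<in> root_angles k \<Longrightarrow> x \<notin> antiroot_angles k"
proof
  assume "x \<in> root_angles k" "x \<in> antiroot_angles k"
  then obtain i j :: int where
    "real k * x = 2 * of_int i * pi" "real k * x = (2 * of_int j + 1) * pi"
    unfolding root_angles_def antiroot_angles_def by blast
  then have "real_of_int (2 * i) = real_of_int (2 * j + 1)" by simp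
  then have "2 * i = 2 * j + 1" by (simp only: of_int_eq_iff)
  then show False by presburger
qed

lemma root_angles_add:
  assumes "x \<in> root_angles k" "y \<in> root_angles k"
  shows "x + y \<in> root_angles k"
proof -
  from assms obtain i j :: int where "real k * x = 2 * of_int i * pi" "real k * y = 2 * of_int j * pi"
    by (auto simp: root_angles_def)
  then have "real k * (x + y) = 2 * of_int (i + j) * pi" by (simp add: algebra_simps)
  then show ?thesis unfolding root_angles_def by blast
qed

lemma root_angles_uminus:
  assumes "x \<in> root_angles k"
  shows "- x \<in> root_angles k"
proof -
  from assms obtain i :: int where "real k * x = 2 * of_int i * pi"
    by (auto simp: root_angles_def)
  then have "real k * - x = 2 * of_int (- i) * pi" by simp
  then show ?thesis unfolding root_angles_def by blast
qed

lemma zero_root_angle: "0 \<in> root_angles k"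
  unfolding root_angles_def by (auto intro: exI[of _ 0])

lemma antiroot_angles_shift:
  assumes "k \<ge> 1"
  shows "pi / real k + x \<in> antiroot_angles k \<longleftrightarrow> x \<in> root_angles k"
  using assms by (simp add: root_angles_def antiroot_angles_def algebra_simps)

lemma antiroot_angles_eq_shift:
  assumes "k \<ge> 1"
  shows "antiroot_angles k = (+) (pi / real k) ` root_angles k"
  using antiroot_angles_shift[OF assms]
  by (auto simp: image_iff) (metis add.commute diff_add_cancel)

lemma pi_root_angle_iff: "pi \<in> root_angles k \<longleftrightarrow> even k"
proof
  assume "pi \<in> root_angles k"
  then obtain i :: int where "real k * pi = 2 * of_int i * pi" by (auto simp: root_angles_def)
  then have "real_of_int (int k) = real_of_int (2 * i)" by simp
  then have "int k = 2 * i" by (simp only: of_int_eq_iff)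
  then show "even k" by presburger
next
  assume "even k"
  then obtain j where "k = 2 * j" by blast
  then have "real k * pi = 2 * of_int (int j) * pi" by simp
  then show "pi \<in> root_angles k" unfolding root_angles_def by blast
qed

text \<open>Bezout: \<open>d x\<close> is an integer combination of \<open>m x\<close> and \<open>n x\<close>.\<close>

lemma root_angles_Int_gcd:
  assumes "d = gcd m n"
  shows "root_angles m \<inter> root_angles n = root_angles d"
proof
  show "root_angles m \<inter> root_angles n \<subseteq> root_angles d"
  proof
    fix x assume "x \<in> root_angles m \<inter> root_angles n"
    then obtain i j :: int where ij: "real m * x = 2 * of_int i * pi" "real n * x = 2 * of_int j * pi"
      by (auto simp: root_angles_def)
    obtain u v where uv: "u * int m + v * int n = int d"
      using bezout_int[of "int m" "int n"] assms by auto
    have "real d * x = real_of_int (u * int m + v * int n) * x" unfolding uv by simp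
    also have "\<dots> = of_int u * (real m * x) + of_int v * (real n * x)"
      by (simp add: algebra_simps)
    also have "\<dots> = 2 * of_int (u * i + v * j) * pi"
      unfolding ij by (simp add: algebra_simps)
    finally show "x \<in> root_angles d" unfolding root_angles_def by blast
  qed
  have "root_angles d \<subseteq> root_angles k" if "d dvd k" for k
  proof
    fix x assume "x \<in> root_angles d"
    then obtain i :: int where i: "real d * x = 2 * of_int i * pi" by (auto simp: root_angles_def)
    obtain c where "k = d * c" using \<open>d dvd k\<close> by (rule dvdE)
    then have "real k * x = real c * (real d * x)" by simp
    then have "real k * x = 2 * of_int (int c * i) * pi" unfolding i by simp
    then show "x \<in> root_angles k" unfolding root_angles_def by blast
  qed
  then show "root_angles d \<subseteq> root_angles m \<inter> root_angles n" using assms by simp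
qed

text \<open>Again by Bezout, \<open>d x = t \<pi>\<close> for an integer \<open>t\<close>. Then \<open>(n / d) t\<close> is odd and \<open>(m / d) t\<close> is even, so
  \<open>t\<close> is odd and \<open>m / d\<close> even. Conversely, when \<open>m / d\<close> is even, \<open>n / d\<close> is odd by coprimality.\<close>

lemma root_antiroot_Int_gcd:
  assumes d: "d = gcd m n" and "m \<ge> 1"
  shows "root_angles m \<inter> antiroot_angles n = (if even (m div d) then antiroot_angles d else {})"
proof -
  define m' n' where "m' = m div d" and "n' = n div d"
  have m': "m = m' * d" and n': "n = n' * d" and co: "coprime m' n'"
    using assms by (auto simp: m'_def n'_def div_gcd_coprime)
  have key: "even m' \<and> x \<in> antiroot_angles d" if x: "x \<in> root_angles m" "x \<in> antiroot_angles n" for x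
  proof -
    from x obtain i j :: int where ij: "real m * x = 2 * of_int i * pi"
        "real n * x = (2 * of_int j + 1) * pi"
      by (auto simp: root_angles_def antiroot_angles_def)
    obtain u v where uv: "u * int m + v * int n = int d"
      using bezout_int[of "int m" "int n"] assms by auto
    define t where "t = 2 * u * i + v * (2 * j + 1)"
    have "real d * x = real_of_int (u * int m + v * int n) * x" unfolding uv by simp
    also have "\<dots> = of_int u * (real m * x) + of_int v * (real n * x)"
      by (simp add: algebra_simps)
    also have "\<dots> = of_int t * pi"
      unfolding ij t_def by (simp add: algebra_simps)
    finally have t: "real d * x = of_int t * pi" .
    have "of_int (int n' * t) * pi = real n * x" using t by (simp add: n')
    then have "real_of_int (int n' * t) = real_of_int (2 * j + 1)" using ij by simp
    then have "int n' * t = 2 * j + 1" by (simp only: of_int_eq_iff)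
    then have odd: "odd t" by (metis dvd_mult dvd_triv_left even_plus_one_iff)
    have "of_int (int m' * t) * pi = real m * x" using t by (simp add: m')
    then have "real_of_int (int m' * t) = real_of_int (2 * i)" using ij by simp
    then have "int m' * t = 2 * i" by (simp only: of_int_eq_iff)
    then have "even m'" using odd by (metis dvd_triv_left even_mult_iff even_of_nat)
    moreover from odd obtain s where "t = 2 * s + 1" by (rule oddE)
    then have "real d * x = (2 * of_int s + 1) * pi" using t by simp
    ultimately show ?thesis unfolding antiroot_angles_def by blast
  qed
  have conv: "x \<in> root_angles m \<inter> antiroot_angles n" if "even m'" "x \<in> antiroot_angles d" for x
  proof -
    from that(2) obtain s :: int where s: "real d * x = (2 * of_int s + 1) * pi"
      by (auto simp: antiroot_angles_def)
    from that(1) obtain c where c: "m' = 2 * c" by blast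
    have "odd n'" using co that(1) coprime_common_divisor by fastforce
    then obtain e where e: "n' = 2 * e + 1" by (rule oddE)
    have "real m * x = real m' * (real d * x)" by (simp add: m')
    also have "\<dots> = 2 * of_int (int c * (2 * s + 1)) * pi" unfolding s c by simp
    finally have "x \<in> root_angles m" unfolding root_angles_def by blast
    moreover have "real n * x = real n' * (real d * x)" by (simp add: n')
    then have "real n * x = (2 * of_int (2 * int e * s + int e + s) + 1) * pi"
      unfolding s e by (simp add: algebra_simps)
    then have "x \<in> antiroot_angles n" unfolding antiroot_angles_def by blast
    ultimately show ?thesis by blast
  qed
  show ?thesis using key conv by (auto simp: m'_def)
qed

section \<open>The groups in terms of angles\<close>

lemma Zgrp_eq:
  assumes "k \<ge> 1"
  shows "Zgrp k = rot e3 ` root_angles k"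
proof
  show "Zgrp k \<subseteq> rot e3 ` root_angles k"
  proof
    fix M assume "M \<in> Zgrp k"
    then obtain j where j: "M = rot e3 (2 * real j * pi / real k)" by (auto simp: Zgrp_def)
    have "real k * (2 * real j * pi / real k) = 2 * of_int (int j) * pi" using assms by simp
    then show "M \<in> rot e3 ` root_angles k" unfolding root_angles_def j by blast
  qed
  show "rot e3 ` root_angles k \<subseteq> Zgrp k"
  proof
    fix M assume "M \<in> rot e3 ` root_angles k"
    then obtain x and i :: int where x: "M = rot e3 x" "real k * x = 2 * of_int i * pi"
      by (auto simp: root_angles_def)
    define j where "j = nat (i mod int k)"
    have j: "j < k" "int j = i mod int k" using assms by (auto simp: j_def nat_less_iff)
    have "i = int j + int k * (i div int k)" using j by simp
    then have "real_of_int i = real j + real k * of_int (i div int k)"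
      by (metis of_int_add of_int_mult of_int_of_nat_eq)
    then have "x = 2 * real j * pi / real k + 2 * pi * of_int (i div int k)"
      using x assms by (simp add: field_simps)
    then have "rot e3 x = rot e3 (2 * real j * pi / real k)"
      unfolding rot_e3_eq_iff by blast
    then show "M \<in> Zgrp k" using j x by (auto simp: Zgrp_def)
  qed
qed

lemma Z2k_minus_eq:
  assumes "k \<ge> 1"
  shows "Z2k_minus k = rot e3 ` root_angles k \<union> (\<lambda>x. - rot e3 x) ` antiroot_angles k"
proof -
  show ?thesis
    unfolding antiroot_angles_eq_shift[OF assms]
    by (simp add: Z2k_minus_def Zgrp_eq[OF assms] l_coset_def image_image
        matrix_mul_uminus_left rot_e3_mult UNION_singleton_eq_range)
qed

lemma Dgrp_eq:
  assumes "k \<ge> 1"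
  shows "Dgrp k = rot e3 ` root_angles k \<union> half_turn ` root_angles k"
proof
  have gen: "2 * pi / real k \<in> root_angles k"
    using assms by (auto simp: root_angles_def intro!: exI[of _ 1])
  have F: "rot e1 pi = half_turn 0" by (simp add: half_turn_def rot_e3_zero)
  show "Dgrp k \<subseteq> rot e3 ` root_angles k \<union> half_turn ` root_angles k"
  proof
    fix M assume "M \<in> Dgrp k"
    then show "M \<in> rot e3 ` root_angles k \<union> half_turn ` root_angles k"
      unfolding Dgrp_def
    proof (induction rule: generate.induct)
      case one
      then show ?case using rot_e3_zero zero_root_angle by (force simp: image_iff)
    next
      case (incl h)
      then show ?case using gen zero_root_angle F by auto
    next
      case (inv h)
      then show ?case using gen zero_root_angle F root_angles_uminus[OF gen]
        by (auto simp: inv_O3 orthogonal_rot_e3 orthogonal_half_turn transpose_rot_e3 transpose_half_turn)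
    next
      case (eng h1 h2)
      then show ?case
        using root_angles_add root_angles_uminus
        by (auto simp: rot_e3_mult rot_e3_half_turn half_turn_rot_e3 half_turn_mult diff_conv_add_uminus
            simp del: add_uminus_conv_diff)
    qed
  qed
  have pow: "rot e3 (2 * real j * pi / real k) \<in> Dgrp k" for j
  proof (induction j)
    case 0
    then show ?case using generate.one[of O3] by (simp add: Dgrp_def rot_e3_zero)
  next
    case (Suc j)
    have "rot e3 (2 * pi / real k) \<in> Dgrp k"
      unfolding Dgrp_def by (rule generate.incl) simp
    then have "rot e3 (2 * pi / real k) ** rot e3 (2 * real j * pi / real k) \<in> Dgrp k"
      using Suc generate.eng[of _ O3] unfolding Dgrp_def by simp
    then show ?case by (simp add: rot_e3_mult algebra_simps add_divide_distrib)
  qed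
  then have Z: "rot e3 ` root_angles k \<subseteq> Dgrp k"
    by (auto simp flip: Zgrp_eq[OF assms] simp: Zgrp_def)
  have "rot e1 pi \<in> Dgrp k" unfolding Dgrp_def by (rule generate.incl) simp
  then have "half_turn x \<in> Dgrp k" if "x \<in> root_angles k" for x
    using that Z generate.eng[of _ O3] unfolding Dgrp_def half_turn_def by auto
  then show "rot e3 ` root_angles k \<union> half_turn ` root_angles k \<subseteq> Dgrp k"
    using Z by auto
qed

lemma D2k_d_eq:
  assumes "k \<ge> 1"
  shows "D2k_d k = rot e3 ` root_angles k \<union> half_turn ` root_angles k
    \<union> (\<lambda>x. - rot e3 x) ` antiroot_angles k \<union> (\<lambda>x. - half_turn x) ` antiroot_angles k"
proof -
  show ?thesis
    unfolding antiroot_angles_eq_shift[OF assms]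
    by (simp add: D2k_d_def Dgrp_eq[OF assms] l_coset_def image_Un image_image Un_assoc
        matrix_mul_uminus_left rot_e3_mult rot_e3_half_turn UNION_singleton_eq_range)
qed

lemma rot_e3_neq_uminus: "rot e3 x \<noteq> - rot e3 y"
  unfolding rot_e3 by (simp add: matrix3_simps)

lemma rot_e3_neq_uminus_half_turn: "rot e3 x \<noteq> - half_turn y"
proof
  assume "rot e3 x = - half_turn y"
  then have "det (rot e3 x) = det (- half_turn y)" by simp
  then show False by (simp add: det_rot_e3 det_half_turn det_uminus3)
qed

lemma half_turn_neq_uminus: "half_turn x \<noteq> - half_turn y"
  unfolding half_turn_matrix by (simp add: matrix3_simps)

text \<open>The four families of elements are pairwise disjoint, being separated by the determinant and the
  lower right entry, and within each family the matrix determines the angle modulo \<open>2\<pi>\<close>.\<close>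

lemma D2k_d_memb:
  assumes "k \<ge> 1"
  shows "rot e3 x \<in> D2k_d k \<longleftrightarrow> x \<in> root_angles k"
    and "half_turn x \<in> D2k_d k \<longleftrightarrow> x \<in> root_angles k"
    and "- rot e3 x \<in> D2k_d k \<longleftrightarrow> x \<in> antiroot_angles k"
    and "- half_turn x \<in> D2k_d k \<longleftrightarrow> x \<in> antiroot_angles k"
proof -
  note ne = rot_e3_neq_half_turn rot_e3_neq_half_turn[symmetric] rot_e3_neq_uminus rot_e3_neq_uminus[symmetric]
    rot_e3_neq_uminus_half_turn rot_e3_neq_uminus_half_turn[symmetric] half_turn_neq_uminus half_turn_neq_uminus[symmetric]
  have ne': "- rot e3 x \<noteq> half_turn y" "half_turn y \<noteq> - rot e3 x" "- half_turn x \<noteq> rot e3 y" for x y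
    using ne by (metis minus_minus)+
  have root: "rot e3 x \<in> rot e3 ` root_angles k \<longleftrightarrow> x \<in> root_angles k"
    "half_turn x \<in> half_turn ` root_angles k \<longleftrightarrow> x \<in> root_angles k"
    using root_angles_cong half_turn_eq_iff by blast+
  have anti: "- rot e3 x \<in> (\<lambda>x. - rot e3 x) ` antiroot_angles k \<longleftrightarrow> x \<in> antiroot_angles k"
    "- half_turn x \<in> (\<lambda>x. - half_turn x) ` antiroot_angles k \<longleftrightarrow> x \<in> antiroot_angles k"
    unfolding image_iff neg_equal_iff_equal half_turn_eq_iff using antiroot_angles_cong by blast+
  show "rot e3 x \<in> D2k_d k \<longleftrightarrow> x \<in> root_angles k"
    unfolding D2k_d_eq[OF assms] Un_iff root using ne ne' by (auto simp: image_iff)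
  show "half_turn x \<in> D2k_d k \<longleftrightarrow> x \<in> root_angles k"
    unfolding D2k_d_eq[OF assms] Un_iff root using ne ne' by (auto simp: image_iff)
  show "- rot e3 x \<in> D2k_d k \<longleftrightarrow> x \<in> antiroot_angles k"
    unfolding D2k_d_eq[OF assms] Un_iff anti neg_equal_iff_equal using ne ne'
    by (auto simp: image_iff)
  show "- half_turn x \<in> D2k_d k \<longleftrightarrow> x \<in> antiroot_angles k"
    unfolding D2k_d_eq[OF assms] Un_iff anti using ne ne' by (auto simp: image_iff)
qed

lemma D2k_d_cases:
  assumes "M \<in> D2k_d k" "k \<ge> 1"
  obtains x where "M = rot e3 x" "x \<in> root_angles k"
    | x where "M = half_turn x" "x \<in> root_angles k"
    | x where "M = - rot e3 x" "x \<in> antiroot_angles k"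
    | x where "M = - half_turn x" "x \<in> antiroot_angles k"
  using assms by (auto simp: D2k_d_eq)

text \<open>An element and its negative would have the same angle modulo \<open>2\<pi>\<close>, being an angle of a root of
  \<open>1\<close> and of a root of \<open>-1\<close> at once. In particular \<open>- mat 1\<close> is not in the group.\<close>

lemma D2k_d_uminus:
  assumes "M \<in> D2k_d k" "k \<ge> 1"
  shows "- M \<notin> D2k_d k"
  using assms(1)
  by (rule D2k_d_cases[OF _ assms(2)])
    (use root_angles_disjoint D2k_d_memb[OF assms(2)] in auto)

lemma plus_Z2c_Zgrp_eq:
  assumes "m \<ge> 1"
  shows "plus_Z2c (Zgrp m) = rot e3 ` root_angles m \<union> (\<lambda>x. - rot e3 x) ` root_angles m"
  using assms by (simp add: plus_Z2c_def Zgrp_eq image_image)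

section \<open>Conjugates with axis \<open>e3\<close>\<close>

lemma conjugate_eq: "orthogonal_matrix g \<Longrightarrow> conjugate g K = (\<lambda>h. g ** h ** transpose g) ` K"
  by (simp add: conjugate_def inv_O3)

lemma conjugate_matrix_eq_iff:
  assumes "orthogonal_matrix (g :: real^3^3)"
  shows "g ** X ** transpose g = Y \<longleftrightarrow> g ** X = Y ** g"
proof -
  have o: "transpose g ** g = mat 1" "g ** transpose g = mat 1"
    using assms by (auto simp: orthogonal_matrix_def)
  have "g ** X ** transpose g ** g = g ** X" "Y ** g ** transpose g = Y"
    using o by (simp_all flip: matrix_mul_assoc)
  then show ?thesis by metis
qed

text \<open>The third column of \<open>g\<close> is \<open>\<plusminus> e3\<close>, so \<open>g\<close> acts on the horizontal plane as an orthogonal map.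
  Rotations of the plane commute with its rotations and are inverted by its reflections.\<close>

lemma conjugate_rot_e3_on_axis:
  fixes g :: "real^3^3"
  assumes g: "orthogonal_matrix g" and ax: "g $ 1 $ 3 = 0" "g $ 2 $ 3 = 0"
  shows "(\<forall>x. g ** rot e3 x ** transpose g = rot e3 x) \<or>
         (\<forall>x. g ** rot e3 x ** transpose g = rot e3 (- x))"
proof -
  have o: "transpose g ** g = mat 1" "g ** transpose g = mat 1"
    using g by (auto simp: orthogonal_matrix_def)
  have e33: "(g $ 3 $ 3)^2 = 1"
    using o(1) ax by (simp add: matrix3_simps power2_eq_square)
  then have g33: "g $ 3 $ 3 \<noteq> 0" by auto
  \<comment> \<open>The third column has norm one, and the others are orthogonal to it.\<close>
  have row: "g $ 3 $ 1 = 0" "g $ 3 $ 2 = 0"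
    using o(1) ax g33 by (auto simp: matrix3_simps)
  define a b c e where abce: "a = g $ 1 $ 1" "b = g $ 1 $ 2" "c = g $ 2 $ 1" "e = g $ 2 $ 2"
  have ob: "a * a + b * b = 1" "c * c + e * e = 1" "a * c + b * e = 0"
    using o(2) ax row by (simp_all add: matrix3_simps abce)
  \<comment> \<open>Lagrange's identity: the determinant of the horizontal block is a sign.\<close>
  have "(a * e - b * c)^2 = (a*a+b*b)*(c*c+e*e) - (a*c+b*e)^2"
    by (simp add: power2_eq_square algebra_simps)
  then have "(a * e - b * c)^2 = 1" using ob by simp
  then have dets: "a * e - b * c = 1 \<or> a * e - b * c = - 1" by (simp add: power2_eq_1_iff)
  have "g ** rot e3 x ** transpose g =
      vector [vector [cos x, - ((a*e-b*c) * sin x), 0], vector [(a*e-b*c) * sin x, cos x, 0],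
        vector [0, 0, 1]]" for x
  proof -
    have 1: "(a * cos x + b * sin x) * a + (b * cos x - a * sin x) * b = cos x"
    proof -
      have "(a * cos x + b * sin x) * a + (b * cos x - a * sin x) * b = (a*a+b*b) * cos x"
        by (simp add: algebra_simps)
      then show ?thesis using ob by simp
    qed
    have 2: "(c * cos x + e * sin x) * c + (e * cos x - c * sin x) * e = cos x"
    proof -
      have "(c * cos x + e * sin x) * c + (e * cos x - c * sin x) * e = (c*c+e*e) * cos x"
        by (simp add: algebra_simps)
      then show ?thesis using ob by simp
    qed
    have 3: "(a * cos x + b * sin x) * c + (b * cos x - a * sin x) * e = - ((a*e-b*c) * sin x)"
    proof -
      have "(a * cos x + b * sin x) * c + (b * cos x - a * sin x) * e
          = (a*c+b*e) * cos x - (a*e-b*c) * sin x"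
        by (simp add: algebra_simps)
      then show ?thesis using ob by simp
    qed
    have 4: "(c * cos x + e * sin x) * a + (e * cos x - c * sin x) * b = (a*e-b*c) * sin x"
    proof -
      have "(c * cos x + e * sin x) * a + (e * cos x - c * sin x) * b
          = (a*c+b*e) * cos x + (a*e-b*c) * sin x"
        by (simp add: algebra_simps)
      then show ?thesis using ob by simp
    qed
    show ?thesis
      using 1 2 3 4 e33 unfolding rot_e3
      by (simp add: matrix3_simps ax row abce[symmetric] power2_eq_square)
  qed
  then show ?thesis using dets unfolding rot_e3 by auto
qed

lemma conjugate_on_axis:
  fixes g :: "real^3^3"
  assumes g: "orthogonal_matrix g" and ax: "g $ 1 $ 3 = 0" "g $ 2 $ 3 = 0" and m: "m \<ge> 1"
  shows "conjugate g (plus_Z2c (Zgrp m)) = plus_Z2c (Zgrp m)"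
proof -
  have neg: "uminus ` root_angles m = root_angles m"
  proof
    show "uminus ` root_angles m \<subseteq> root_angles m" using root_angles_uminus by auto
    show "root_angles m \<subseteq> uminus ` root_angles m"
    proof
      fix x assume "x \<in> root_angles m"
      then have "- x \<in> root_angles m" by (rule root_angles_uminus)
      then show "x \<in> uminus ` root_angles m" by (metis image_eqI minus_minus)
    qed
  qed
  have sw: "(\<lambda>x. f (- x)) ` root_angles m = f ` root_angles m" for f :: "real \<Rightarrow> real^3^3"
    using neg by (metis image_image)
  from conjugate_rot_e3_on_axis[OF g ax] show ?thesis
    by (elim disjE) (simp_all add: conjugate_eq[OF g] plus_Z2c_Zgrp_eq[OF m] image_Un image_image
        matrix_mul_uminus_left matrix_mul_uminus_right sw[of "rot e3"] sw[of "\<lambda>x. - rot e3 x"])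
qed

lemma D2k_d_Int_on_axis:
  assumes "m \<ge> 1" "n \<ge> 1" "d = gcd m n"
  shows "D2k_d n \<inter> plus_Z2c (Zgrp m) = (if even (m div d) then Z2k_minus d else Zgrp d)"
proof -
  have d: "d \<ge> 1" using assms by (simp add: Suc_le_eq)
  have "D2k_d n \<inter> plus_Z2c (Zgrp m) =
      rot e3 ` (root_angles m \<inter> root_angles n) \<union> (\<lambda>x. - rot e3 x) ` (root_angles m \<inter> antiroot_angles n)"
    unfolding plus_Z2c_Zgrp_eq[OF assms(1)]
    by (auto simp: D2k_d_memb[OF assms(2)])
  also have "\<dots> = (if even (m div d) then Z2k_minus d else Zgrp d)"
    unfolding root_angles_Int_gcd[OF assms(3)] root_antiroot_Int_gcd[OF assms(3,1)]
    by (simp add: Z2k_minus_eq[OF d] Zgrp_eq[OF d])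
  finally show ?thesis .
qed

section \<open>Conjugates with another axis\<close>

lemma det_conjugate:
  fixes g X :: "real^3^3"
  assumes g: "orthogonal_matrix g"
  shows "det (g ** X ** transpose g) = det X"
proof -
  have "det g * det g = 1"
    using det_orthogonal_matrix[OF g] by auto
  then show ?thesis by (simp add: det_mul det_transpose)
qed

text \<open>A rotation about \<open>e3\<close> that fixes a vector with nonzero horizontal part is the identity.\<close>

lemma conjugate_off_axis_rot:
  fixes g :: "real^3^3"
  assumes g: "orthogonal_matrix g" and off: "g $ 1 $ 3 \<noteq> 0 \<or> g $ 2 $ 3 \<noteq> 0"
    and eq: "g ** rot e3 x ** transpose g = rot e3 t"
  shows "rot e3 t = mat 1" and "rot e3 x = mat 1"
proof -
  define a b where ab: "a = g $ 1 $ 3" "b = g $ 2 $ 3"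
  have "g ** rot e3 x = rot e3 t ** g" using eq conjugate_matrix_eq_iff[OF g] by blast
  \<comment> \<open>The third column is fixed by \<open>rot e3 t\<close>; taking the inner product of its horizontal part with
     its image shows that the cosine is one.\<close>
  then have "a = cos t * a - sin t * b" "b = sin t * a + cos t * b"
    unfolding rot_e3 by (simp_all add: matrix3_simps ab)
  then have "a * a + b * b = (cos t * a - sin t * b) * a + (sin t * a + cos t * b) * b" by metis
  also have "\<dots> = cos t * (a * a + b * b)" by (simp add: algebra_simps)
  finally have "a * a + b * b = cos t * (a * a + b * b)" .
  moreover have "a * a + b * b \<noteq> 0" using off ab by (simp add: sum_squares_eq_zero_iff)
  ultimately have "cos t = 1" by auto
  then have "sin t = 0" using sin_cos_squared_add[of t] by simp
  with \<open>cos t = 1\<close> show t: "rot e3 t = mat 1" unfolding rot_e3 by (simp add: matrix3_simps)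
  have o: "transpose g ** g = mat 1" using g by (simp add: orthogonal_matrix_def)
  have "g ** rot e3 x = g" using \<open>g ** rot e3 x = rot e3 t ** g\<close> t by simp
  then show "rot e3 x = mat 1" using o by (metis matrix_mul_assoc matrix_mul_lid)
qed

text \<open>A rotation conjugate to a half-turn is a half-turn, because it is symmetric and not the identity.
  Its axis \<open>g e3\<close> is fixed by a half-turn that reverses vertical components, so it is horizontal.\<close>

lemma conjugate_rot_eq_half_turn:
  fixes g :: "real^3^3"
  assumes g: "orthogonal_matrix g" and eq: "g ** rot e3 x ** transpose g = half_turn t"
  shows "g $ 3 $ 3 = 0" and "rot e3 x = rot e3 pi"
proof -
  have gx: "g ** rot e3 x = half_turn t ** g" using eq conjugate_matrix_eq_iff[OF g] by blast
  then have "g $ 3 $ 3 = - g $ 3 $ 3"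
    unfolding rot_e3 half_turn_matrix by (simp add: matrix3_simps)
  then show "g $ 3 $ 3 = 0" by simp
  have o: "transpose g ** g = mat 1" using g by (simp add: orthogonal_matrix_def)
  have "rot e3 x = transpose g ** half_turn t ** g"
    using gx o by (metis matrix_mul_assoc matrix_mul_lid)
  then have "transpose (rot e3 x) = rot e3 x"
    by (simp add: matrix_transpose_mul transpose_half_turn matrix_mul_assoc)
  then have s: "sin x = 0" unfolding rot_e3 by (simp add: matrix3_simps)
  have "cos x \<noteq> 1"
  proof
    assume "cos x = 1"
    then have "rot e3 x = mat 1" using s unfolding rot_e3 by (simp add: matrix3_simps)
    then have "half_turn t = mat 1" using eq g by (simp add: orthogonal_matrix_def)
    then show False using rot_e3_neq_half_turn[of 0 t] rot_e3_zero by simp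
  qed
  then have "cos x = - 1" using s sin_cos_squared_add[of x] by (auto simp: power2_eq_1_iff)
  then show "rot e3 x = rot e3 pi" using s unfolding rot_e3 by simp
qed

text \<open>The determinant, invariant under conjugation, forces \<open>X\<close> and its conjugate to carry the same sign.
  Removing that sign leaves a rotation conjugate to a rotation about \<open>e3\<close> or to a half-turn. The
  value \<open>X = - mat 1\<close> is excluded because \<open>0\<close> is not the angle of a root of \<open>-1\<close>.\<close>

lemma conjugate_off_axis_cases:
  fixes g :: "real^3^3"
  assumes g: "orthogonal_matrix g" and off: "g $ 1 $ 3 \<noteq> 0 \<or> g $ 2 $ 3 \<noteq> 0"
    and n: "n \<ge> 1" and X: "X = rot e3 x \<or> X = - rot e3 x"
    and D: "g ** X ** transpose g \<in> D2k_d n"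
  shows "X = mat 1 \<or> g $ 3 $ 3 = 0 \<and> (X = rot e3 pi \<or> X = - rot e3 pi)"
proof -
  have det: "det (g ** X ** transpose g) = det X" by (rule det_conjugate[OF g])
  note dets = det_rot_e3 det_half_turn det_uminus3
  show ?thesis
    using D n
  proof (cases rule: D2k_d_cases)
    case (1 t)
    then have "X = rot e3 x" using det X by (auto simp: dets)
    then show ?thesis using conjugate_off_axis_rot(2)[OF g off] 1 by auto
  next
    case (2 t)
    then have "X = rot e3 x" using det X by (auto simp: dets)
    then show ?thesis using conjugate_rot_eq_half_turn[OF g] 2 by auto
  next
    case (3 t)
    then have Xx: "X = - rot e3 x" using det X by (auto simp: dets)
    then have "g ** rot e3 x ** transpose g = rot e3 t"
      using 3 by (simp add: matrix_mul_uminus_left matrix_mul_uminus_right)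
    then have "rot e3 t = rot e3 0"
      using conjugate_off_axis_rot(1)[OF g off] by (simp add: rot_e3_zero)
    then have "t \<in> root_angles n" using root_angles_cong zero_root_angle by blast
    then show ?thesis using 3 root_angles_disjoint by blast
  next
    case (4 t)
    then have Xx: "X = - rot e3 x" using det X by (auto simp: dets)
    then have "g ** rot e3 x ** transpose g = half_turn t"
      using 4 by (simp add: matrix_mul_uminus_left matrix_mul_uminus_right)
    then show ?thesis using conjugate_rot_eq_half_turn[OF g] Xx by auto
  qed
qed

lemma Zgrp_1: "Zgrp 1 = trivial_grp"
  by (simp add: Zgrp_def trivial_grp_def rot_e3_zero)

lemma Zgrp_2: "Zgrp 2 = {mat 1, rot e3 pi}"
proof -
  have "{j. j < (2::nat)} = {0, 1}" by auto
  then have "Zgrp 2 = (\<lambda>j. rot e3 (2 * real j * pi / real 2)) ` {0, 1}"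
    unfolding Zgrp_def by blast
  then show ?thesis by (simp add: rot_e3_zero)
qed

lemma Z2k_minus_1: "Z2k_minus 1 = {mat 1, - rot e3 pi}"
  unfolding Z2k_minus_def Zgrp_1 by (simp add: trivial_grp_def l_coset_def insert_commute)

text \<open>Pulled back by \<open>g\<close>, the intersection becomes the set \<open>K\<close> of those elements of the cyclic group with
  inversion whose conjugates lie in \<open>D2k_d n\<close>; besides the identity it can only contain one of
  \<open>\<plusminus> rot e3 pi\<close>.\<close>

lemma Int_conjugate_off_axis:
  fixes g :: "real^3^3"
  assumes g: "orthogonal_matrix g" and off: "g $ 1 $ 3 \<noteq> 0 \<or> g $ 2 $ 3 \<noteq> 0"
    and n: "n \<ge> 1" and m: "m \<ge> 1"
  defines "I \<equiv> D2k_d n \<inter> conjugate g (plus_Z2c (Zgrp m))"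
    and "h \<equiv> g ** rot e3 pi ** transpose g"
  shows "even m \<Longrightarrow> h \<in> D2k_d n \<Longrightarrow> I = conjugate g (Zgrp 2)"
    and "even m \<Longrightarrow> - h \<in> D2k_d n \<Longrightarrow> I = conjugate g (Z2k_minus 1)"
    and "odd m \<or> g $ 3 $ 3 \<noteq> 0 \<or> h \<notin> D2k_d n \<and> - h \<notin> D2k_d n \<Longrightarrow> I = conjugate g trivial_grp"
proof -
  define K where "K = {X \<in> plus_Z2c (Zgrp m). g ** X ** transpose g \<in> D2k_d n}"
  have I: "I = conjugate g K" unfolding I_def K_def conjugate_eq[OF g] by blast
  have "rot e3 0 \<in> plus_Z2c (Zgrp m)" "rot e3 0 \<in> D2k_d n"
    using zero_root_angle D2k_d_memb(1)[OF n] by (auto simp: plus_Z2c_Zgrp_eq[OF m])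
  then have one: "mat 1 \<in> K"
    using g by (simp add: K_def rot_e3_zero orthogonal_matrix_def)
  have sub: "X = mat 1 \<or> g $ 3 $ 3 = 0 \<and> (X = rot e3 pi \<or> X = - rot e3 pi)" if "X \<in> K" for X
    using that conjugate_off_axis_cases[OF g off n] by (auto simp: K_def plus_Z2c_Zgrp_eq[OF m])
  have "rot e3 pi \<in> plus_Z2c (Zgrp m) \<longleftrightarrow> pi \<in> root_angles m"
    "- rot e3 pi \<in> plus_Z2c (Zgrp m) \<longleftrightarrow> pi \<in> root_angles m"
    unfolding plus_Z2c_Zgrp_eq[OF m] Un_iff image_iff neg_equal_iff_equal
    using root_angles_cong rot_e3_neq_uminus rot_e3_neq_uminus[symmetric] by blast+
  then have K: "rot e3 pi \<in> K \<longleftrightarrow> even m \<and> h \<in> D2k_d n"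
    "- rot e3 pi \<in> K \<longleftrightarrow> even m \<and> - h \<in> D2k_d n"
    by (auto simp: K_def h_def matrix_mul_uminus_left matrix_mul_uminus_right pi_root_angle_iff)
  have excl: "h \<in> D2k_d n \<Longrightarrow> - h \<notin> D2k_d n" using D2k_d_uminus[OF _ n] by blast
  show "I = conjugate g (Zgrp 2)" if "even m" "h \<in> D2k_d n"
  proof -
    have "K = Zgrp 2" unfolding Zgrp_2 using K excl that one sub by blast
    then show ?thesis by (simp add: I)
  qed
  show "I = conjugate g (Z2k_minus 1)" if "even m" "- h \<in> D2k_d n"
  proof -
    have "K = Z2k_minus 1" unfolding Z2k_minus_1 using K excl that one sub by blast
    then show ?thesis by (simp add: I)
  qed
  show "I = conjugate g trivial_grp"
    if "odd m \<or> g $ 3 $ 3 \<noteq> 0 \<or> h \<notin> D2k_d n \<and> - h \<notin> D2k_d n"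
  proof -
    have "K = trivial_grp" unfolding trivial_grp_def using K that one sub by blast
    then show ?thesis by (simp add: I)
  qed
qed

section \<open>The clips product\<close>

text \<open>A rotation about \<open>e1\<close> with rational entries that moves \<open>e3\<close> to an axis neither vertical nor
  horizontal.\<close>

definition tilt :: "real^3^3" where
  "tilt = vector [vector [1, 0, 0], vector [0, 3/5, - 4/5], vector [0, 4/5, 3/5]]"

lemma orthogonal_tilt: "orthogonal_matrix tilt"
  by (simp add: orthogonal_matrix_def tilt_def matrix3_simps)

definition cycle_axes :: "real^3^3" where
  "cycle_axes = vector [vector [0, 0, 1], vector [1, 0, 0], vector [0, 1, 0]]"

lemma orthogonal_cycle_axes: "orthogonal_matrix cycle_axes"
  by (simp add: orthogonal_matrix_def cycle_axes_def matrix3_simps)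

text \<open>Permuting the coordinate axes sends \<open>e3\<close> to \<open>e1\<close>, and a rotation by \<open>t / 2\<close> about \<open>e3\<close> then brings
  it to the axis of \<open>half_turn t\<close>.\<close>

lemma ex_conjugate_rot_pi_eq_half_turn:
  obtains g :: "real^3^3" where "orthogonal_matrix g" "g $ 1 $ 3 \<noteq> 0 \<or> g $ 2 $ 3 \<noteq> 0"
    "g ** rot e3 pi ** transpose g = half_turn t"
proof
  let ?g = "rot e3 (t / 2) ** cycle_axes"
  show "orthogonal_matrix ?g"
    by (simp add: orthogonal_matrix_mul orthogonal_rot_e3 orthogonal_cycle_axes)
  have "cos (t / 2) \<noteq> 0 \<or> sin (t / 2) \<noteq> 0"
    using sin_zero_abs_cos_one[of "t / 2"] by auto
  then show "?g $ 1 $ 3 \<noteq> 0 \<or> ?g $ 2 $ 3 \<noteq> 0"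
    unfolding rot_e3 cycle_axes_def by (simp add: matrix3_simps)
  have c: "cycle_axes ** rot e3 pi ** transpose cycle_axes = half_turn 0"
    unfolding rot_e3 cycle_axes_def half_turn_matrix by (simp add: matrix3_simps)
  have "?g ** rot e3 pi ** transpose ?g =
      rot e3 (t / 2) ** (cycle_axes ** rot e3 pi ** transpose cycle_axes) ** transpose (rot e3 (t / 2))"
    by (simp add: matrix_transpose_mul matrix_mul_assoc)
  also have "\<dots> = half_turn t"
    unfolding c by (simp add: transpose_rot_e3 rot_e3_half_turn half_turn_rot_e3)
  finally show "?g ** rot e3 pi ** transpose ?g = half_turn t" .
qed

theorem lemma4p13:
  fixes m n d :: nat
  assumes "m \<ge> 2" and "n \<ge> 2" and "d = gcd m n"
  shows "conj_class (D2k_d n) \<circledcirc> conj_class (plus_Z2c (Zgrp m)) =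
    (if even (m div d)
       then {conj_class trivial_grp, conj_class (Zgrp 2), conj_class (Z2k_minus 1),
             conj_class (Z2k_minus d)}
     else if even m \<and> odd (m div d)
       then {conj_class trivial_grp, conj_class (Zgrp 2), conj_class (Z2k_minus 1),
             conj_class (Zgrp d)}
     else {conj_class trivial_grp, conj_class (Zgrp d)})"
proof -
  have m: "m \<ge> 1" and n: "n \<ge> 1" using assms by auto
  \<comment> \<open>\<open>on\<close> is the intersection for a vertical axis, and \<open>T\<close> collects the two classes of order two that a
     horizontal axis contributes. The three cases of the statement differ only in these two terms.\<close>
  define I where "I g = D2k_d n \<inter> conjugate g (plus_Z2c (Zgrp m))" for g
  define on where "on = (if even (m div d) then Z2k_minus d else Zgrp d)"
  define T where "T = (if even m then {conj_class (Zgrp 2), conj_class (Z2k_minus 1)} else {})"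
  have even_m: "even m" if "even (m div d)"
    using that assms(3) by (metis dvd_div_mult_self dvd_mult2 gcd_dvd1)
  have axis: "I g = on" if "orthogonal_matrix g" "g $ 1 $ 3 = 0" "g $ 2 $ 3 = 0" for g
    unfolding I_def on_def conjugate_on_axis[OF that m] by (rule D2k_d_Int_on_axis[OF m n assms(3)])
  have ub: "conj_class (I g) \<in> {conj_class trivial_grp, conj_class on} \<union> T"
    if g: "orthogonal_matrix g" for g
  proof (cases "g $ 1 $ 3 = 0 \<and> g $ 2 $ 3 = 0")
    case True
    then show ?thesis using axis[OF g] by simp
  next
    case False
    then have off: "g $ 1 $ 3 \<noteq> 0 \<or> g $ 2 $ 3 \<noteq> 0" by blast
    let ?h = "g ** rot e3 pi ** transpose g"
    note I = Int_conjugate_off_axis[OF g off n m, folded I_def]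
    consider "even m" "?h \<in> D2k_d n" | "even m" "- ?h \<in> D2k_d n"
      | "odd m \<or> ?h \<notin> D2k_d n \<and> - ?h \<notin> D2k_d n" by blast
    then show ?thesis
    proof cases
      case 1 then show ?thesis using I(1) by (simp add: T_def conj_class_conjugate[OF g])
    next
      case 2 then show ?thesis using I(2) by (simp add: T_def conj_class_conjugate[OF g])
    next
      case 3
      then have "I g = conjugate g trivial_grp" using I(3) by blast
      then show ?thesis by (simp add: conj_class_conjugate[OF g])
    qed
  qed
  have ex_on: "\<exists>g. orthogonal_matrix g \<and> conj_class (I g) = conj_class on"
  proof -
    have "I (mat 1) = on" by (rule axis) (simp_all add: orthogonal_matrix_id, simp_all add: mat_def)
    then show ?thesis using orthogonal_matrix_id by metis
  qed
  have ex_triv: "\<exists>g. orthogonal_matrix g \<and> conj_class (I g) = conj_class trivial_grp"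
  proof -
    have "I tilt = conjugate tilt trivial_grp"
      unfolding I_def using orthogonal_tilt
      by (intro Int_conjugate_off_axis(3)[OF _ _ n m]) (auto simp: tilt_def)
    then show ?thesis using orthogonal_tilt conj_class_conjugate by metis
  qed
  have ex_Z2: "\<exists>g. orthogonal_matrix g \<and> conj_class (I g) = conj_class (Zgrp 2)" if ev: "even m"
  proof -
    obtain g where g: "orthogonal_matrix g" "g $ 1 $ 3 \<noteq> 0 \<or> g $ 2 $ 3 \<noteq> 0"
        "g ** rot e3 pi ** transpose g = half_turn 0"
      using ex_conjugate_rot_pi_eq_half_turn .
    have "half_turn 0 \<in> D2k_d n" using D2k_d_memb(2)[OF n] zero_root_angle by blast
    then have "I g = conjugate g (Zgrp 2)"
      unfolding I_def using Int_conjugate_off_axis(1)[OF g(1,2) n m ev] g(3) by simp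
    then show ?thesis using g(1) conj_class_conjugate by metis
  qed
  have ex_Z2m: "\<exists>g. orthogonal_matrix g \<and> conj_class (I g) = conj_class (Z2k_minus 1)"
    if ev: "even m"
  proof -
    obtain g where g: "orthogonal_matrix g" "g $ 1 $ 3 \<noteq> 0 \<or> g $ 2 $ 3 \<noteq> 0"
        "g ** rot e3 pi ** transpose g = half_turn (pi / real n)"
      using ex_conjugate_rot_pi_eq_half_turn .
    have "pi / real n + 0 \<in> antiroot_angles n"
      using antiroot_angles_shift[OF n, of 0] zero_root_angle by blast
    then have "- half_turn (pi / real n) \<in> D2k_d n" using D2k_d_memb(4)[OF n] by simp
    then have "I g = conjugate g (Z2k_minus 1)"
      unfolding I_def using Int_conjugate_off_axis(2)[OF g(1,2) n m ev] g(3) by simp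
    then show ?thesis using g(1) conj_class_conjugate by metis
  qed
  have "conj_class (D2k_d n) \<circledcirc> conj_class (plus_Z2c (Zgrp m))
      = {conj_class (I g) | g. orthogonal_matrix g}"
    by (simp add: clips_conj_class I_def)
  also have "\<dots> = {conj_class trivial_grp, conj_class on} \<union> T"
  proof
    show "{conj_class (I g) | g. orthogonal_matrix g} \<subseteq> {conj_class trivial_grp, conj_class on} \<union> T"
      using ub by blast
    have "X \<in> {conj_class (I g) | g. orthogonal_matrix g}"
      if "X \<in> {conj_class trivial_grp, conj_class on} \<union> T" for X
    proof -
      from that consider "X = conj_class trivial_grp" | "X = conj_class on"
        | "even m" "X = conj_class (Zgrp 2)" | "even m" "X = conj_class (Z2k_minus 1)"
        by (auto simp: T_def split: if_splits)
      then show ?thesis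
        by cases (use ex_on ex_triv ex_Z2 ex_Z2m in \<open>simp, metis\<close>)+
    qed
    then show "{conj_class trivial_grp, conj_class on} \<union> T \<subseteq> {conj_class (I g) | g. orthogonal_matrix g}"
      by blast
  qed
  also have "\<dots> = (if even (m div d)
       then {conj_class trivial_grp, conj_class (Zgrp 2), conj_class (Z2k_minus 1),
             conj_class (Z2k_minus d)}
     else if even m \<and> odd (m div d)
       then {conj_class trivial_grp, conj_class (Zgrp 2), conj_class (Z2k_minus 1),
             conj_class (Zgrp d)}
     else {conj_class trivial_grp, conj_class (Zgrp d)})"
    using even_m by (auto simp: T_def on_def)
  finally show ?thesis .
qed

end
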